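(* Let $n,k,s$ be positive integers with $n>2^5 s\log_2(sk)$. Then the sequence $(f_1,\ldots,f_s)$ with $$f_i=(i-1)n^{k-1} + 4(s-1)^2 n^{k-2} + 2^{15}s^3 \log_2^3(sk)\, n^{k-3},\qquad i\in[s],$$ is satisfying; that is, whenever $\mathcal F_1,\ldots,\mathcal F_s\subset [n]^k$ satisfy $|\mathcal F_i|>f_i$ for every $i\in[s]$, there exist pairwise disjoint $F_1\in\mathcal F_1,\ldots,F_s\in\mathcal F_s$.
   Context: $[n]=\{1,\ldots,n\}$ and $[n]^k$ is the set of all $k$-tuples $(x_1,\ldots,x_k)$ with $x_j\in[n]$. A tuple $(x_1,\ldots,x_k)$ is identified with the $k$-element set $\{(1,x_1),\ldots,(k,x_k)\}\subset[k]\times[n]$; thus two tuples $x,y$ are disjoint iff $x_j\neq y_j$ for all $j\in[k]$. A sequence of reals $(f_1,\ldots,f_s)$ is satisfying if for all families $\mathcal F_1,\ldots,\mathcal F_s\subset[n]^k$ with $|\mathcal F_i|>f_i$ for each $i$, there exist pairwise disjoint $F_1\in\mathcal F_1,\ldots,F_s\in\mathcal F_s$ (a rainbow matching). *)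

theory Defs
  imports Complex_Main "HOL-Library.FuncSet" "HOL-Library.Disjoint_Sets"
begin

definition tuples :: "nat \<Rightarrow> nat \<Rightarrow> (nat \<Rightarrow> nat) set" where
  "tuples n k = {1..k} \<rightarrow>\<^sub>E {1..n}"

definition tuple_set :: "nat \<Rightarrow> (nat \<Rightarrow> nat) \<Rightarrow> (nat \<times> nat) set" where
  "tuple_set k x = {(j, x j) | j. j \<in> {1..k}}"

(* Sequences of length s are functions on nat of which only the values
   at indices 1, ..., s matter. *)
definition satisfying :: "nat \<Rightarrow> nat \<Rightarrow> nat \<Rightarrow> (nat \<Rightarrow> real) \<Rightarrow> bool" where
  "satisfying n k s f \<longleftrightarrow>
    (\<forall>\<F> :: nat \<Rightarrow> (nat \<Rightarrow> nat) set.
      (\<forall>i\<in>{1..s}. \<F> i \<subseteq> tuples n k \<and> real (card (\<F> i)) > f i) \<longrightarrow>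
      (\<exists>F. (\<forall>i\<in>{1..s}. F i \<in> \<F> i) \<and> disjoint_family_on (\<lambda>i. tuple_set k (F i)) {1..s}))"

end

theory Submission
  imports Defs
begin

text \<open>Put \<kappa> = 32 s log(sk), with logarithm to base 2. Call a family G of supersets of S spread above S if each
  set T disjoint from S is contained in at most a fraction \<kappa>^(-|T|) of the members of G. A family
  of k-tuples not containing any subfamily spread above a set of size at most 2 has at most
  \<kappa>^3 n^(k-3) members, so all but these members of the i-th family contain a set from the collection of
  all S with |S| \<le> 2 above which the i-th family has a spread subfamily. The terms
  (i-1) n^(k-1) and 4(s-1)^2 n^(k-2) allow pairwise disjoint S_1, ..., S_s to be chosen greedily from
  these collections. Discarding from the subfamily above S_i the tuples that meet another S_j
  costs little spreadness.

  It remains to find a rainbow matching in sufficiently spread families. Colour the ground set uniformly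
  at random with s b colours, where 2^b > sk, and reserve b colours for each family. When a new colour
  class W is revealed, each member A is replaced by a smallest fragment A' - W with A' contained in
  A \<union> W and |A'| \<le> |A|. Fragments are subsets of the members they replace, so the family stays spread,
  and the expected average size halves (a counting argument in the style of Park and Pham). After b colours it
  is below 1/s, hence with positive probability every family has a member coloured by its own colours.\<close>

section \<open>Minimal fragments\<close>

text \<open>Families are indexed so that members with equal fragments stay distinct and the index
  set \<open>I\<close> survives every round. Competitors larger than \<open>A i\<close> are
  excluded, so that the smallest member used to encode a fragment has at most
  \<open>card (A i)\<close> points.\<close>

definition frag :: "'i set \<Rightarrow> ('i \<Rightarrow> 'a set) \<Rightarrow> 'a set \<Rightarrow> 'i \<Rightarrow> 'a set" where
  "frag I A W i =
    A (arg_min (\<lambda>j. card (A j - W)) (\<lambda>j. j \<in> I \<and> A j \<subseteq> A i \<union> W \<and> card (A j) \<le> card (A i))) - W"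

lemma frag_cases:
  assumes "i \<in> I"
  obtains j where "j \<in> I" "frag I A W i = A j - W" "A j \<subseteq> A i \<union> W" "card (A j) \<le> card (A i)"
    "\<And>l. l \<in> I \<Longrightarrow> A l \<subseteq> A i \<union> W \<Longrightarrow> card (A l) \<le> card (A i) \<Longrightarrow> card (A j - W) \<le> card (A l - W)"
proof -
  let ?P = "\<lambda>j. j \<in> I \<and> A j \<subseteq> A i \<union> W \<and> card (A j) \<le> card (A i)"
  let ?f = "\<lambda>j. card (A j - W)"
  have "?P i" using assms by auto
  from arg_min_nat_lemma[of ?P, OF this, of ?f]
  show thesis using that[of "arg_min ?f ?P"] unfolding frag_def by blast
qed

text \<open>The value depends on \<open>Z\<close> alone, which makes it usable for decoding; it is
  unspecified if no member lies in \<open>Z\<close>.\<close>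

definition smallest :: "'i set \<Rightarrow> ('i \<Rightarrow> 'a set) \<Rightarrow> 'a set \<Rightarrow> 'a set" where
  "smallest I A Z = A (arg_min (\<lambda>j. card (A j)) (\<lambda>j. j \<in> I \<and> A j \<subseteq> Z))"

lemma smallest_cases:
  assumes "i \<in> I" "A i \<subseteq> Z"
  obtains j where "j \<in> I" "smallest I A Z = A j" "A j \<subseteq> Z"
    "\<And>l. l \<in> I \<Longrightarrow> A l \<subseteq> Z \<Longrightarrow> card (A j) \<le> card (A l)"
proof -
  let ?P = "\<lambda>j. j \<in> I \<and> A j \<subseteq> Z"
  have "?P i" using assms by auto
  from arg_min_nat_lemma[of ?P, OF this, of "\<lambda>j. card (A j)"]
  show thesis using that[of "arg_min (\<lambda>j. card (A j)) ?P"] unfolding smallest_def by blast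
qed

lemma frag_subset:
  assumes "i \<in> I"
  shows "frag I A W i \<subseteq> A i - W"
  using assms by (rule frag_cases[where A=A and W=W]) auto

text \<open>Let T be the fragment. The smallest member \<open>A l\<close> inside W \<union> T is
  itself a competitor in the definition of T. Minimality gives |T| \<le> |A l - W|, while A l - W is
  contained in T, so the two coincide.\<close>

lemma frag_subset_smallest:
  assumes "i \<in> I" "finite X" "\<And>i. i \<in> I \<Longrightarrow> A i \<subseteq> X"
  shows "frag I A W i \<subseteq> smallest I A (W \<union> frag I A W i)"
    and "card (smallest I A (W \<union> frag I A W i)) \<le> card (A i)"
    and "smallest I A (W \<union> frag I A W i) \<in> A ` I"
proof -
  obtain j where j: "j \<in> I" "frag I A W i = A j - W" "A j \<subseteq> A i \<union> W" "card (A j) \<le> card (A i)"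
    and min: "\<And>l. l \<in> I \<Longrightarrow> A l \<subseteq> A i \<union> W \<Longrightarrow> card (A l) \<le> card (A i) \<Longrightarrow> card (A j - W) \<le> card (A l - W)"
    using frag_cases[OF assms(1)] by metis
  have "A j \<subseteq> W \<union> frag I A W i" using j(2) by auto
  from smallest_cases[of j I A, OF j(1) this]
  obtain l where l: "l \<in> I" "smallest I A (W \<union> frag I A W i) = A l" "A l \<subseteq> W \<union> frag I A W i"
    "card (A l) \<le> card (A j)" using j(1) \<open>A j \<subseteq> W \<union> frag I A W i\<close> by metis
  have "card (A j - W) \<le> card (A l - W)"
    using l j by (intro min) auto
  moreover have "A l - W \<subseteq> A j - W" using l(3) j(2) by auto
  moreover have "finite (A j - W)" using assms j(1) finite_subset by blast
  ultimately have "A l - W = A j - W" by (metis card_seteq)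
  then show "frag I A W i \<subseteq> smallest I A (W \<union> frag I A W i)" using l j by auto
  show "card (smallest I A (W \<union> frag I A W i)) \<le> card (A i)" using l j by simp
  show "smallest I A (W \<union> frag I A W i) \<in> A ` I" using l by auto
qed

section \<open>One random class halves the average size\<close>

lemma sum_powers_Pow:
  fixes q :: "'a::comm_semiring_1"
  assumes "finite X"
  shows "(\<Sum>W\<in>Pow X. q ^ card (X - W)) = (q + 1) ^ card X"
  using prod_add[OF assms, of "\<lambda>_. 1" "\<lambda>_. q"] by (simp add: add.commute)

text \<open>Integers rather than naturals, because the exponent 4|T| - |M| in the counting argument
  can be negative.\<close>

lemma real_le_power2: "real_of_int u \<le> 2 powr u"
proof (cases "u \<le> 0")
  case True then show ?thesis
    by (smt (verit) of_int_le_0_iff powr_gt_zero)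
next
  case False
  then have "u = int (nat u)" by simp
  then obtain m where "u = int m" by blast
  then show ?thesis using of_nat_less_two_power[of m, where 'a=real] by (simp add: powr_realpow)
qed

text \<open>Weighting W by q^|X - W| makes W a random subset of density 1/(q + 1). A pair (W, i) is
  encoded by Z = W \<union> T, T = frag I A W i, and i. By minimality T lies in the smallest member M
  contained in Z, so there are at most 2^|M| choices for T. This is balanced by
  4|T| - |A i| \<le> 4|T| - |M| \<le> 16^|T| / 2^|M|.\<close>

lemma sum_card_frag_le:
  fixes q :: real and A :: "'i \<Rightarrow> 'a set"
  assumes "finite I" "finite X" "\<And>i. i \<in> I \<Longrightarrow> A i \<subseteq> X" "0 \<le> q"
    and spread: "\<And>T. T \<subseteq> X \<Longrightarrow> real (card {i\<in>I. T \<subseteq> A i}) * (16 * q) ^ card T \<le> real (card I)"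
  shows "(\<Sum>W\<in>Pow X. q ^ card (X - W) * (\<Sum>i\<in>I. real (card (frag I A W i))))
    \<le> (q + 1) ^ card X * (\<Sum>i\<in>I. real (card (A i))) / 2"
proof -
  define T where "T W i = frag I A W i" for W i
  define m where "m Z = smallest I A Z" for Z
  \<comment> \<open>Requiring \<open>m Z\<close> to be a member keeps it finite even where
    \<open>smallest\<close> is unspecified. Pairs with \<open>m Z = {}\<close> have an empty
    fragment and contribute nothing positive, so they are left out.\<close>
  define Q where "Q = Sigma {Z\<in>Pow X. m Z \<in> A ` I \<and> m Z \<noteq> {}} (\<lambda>Z. Sigma (Pow (m Z)) (\<lambda>T. {i\<in>I. T \<subseteq> A i}))"
  define g where "g = (\<lambda>(Z :: 'a set, T :: 'a set, i :: 'i). q ^ card (X - Z) * ((16 * q) ^ card T / 2 ^ card (m Z)))"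
  have mX: "m Z \<subseteq> X" if "m Z \<in> A ` I" for Z using that assms(3) by auto
  have finm: "finite (m Z)" if "m Z \<in> A ` I" for Z using mX[OF that] assms(2) finite_subset by auto
  have finQ: "finite Q" unfolding Q_def using assms(1,2) finm
    by (intro finite_SigmaI) auto
  have g0: "0 \<le> g z" for z using assms(4) by (cases z) (auto simp: g_def)
  have main: "q ^ card (X - W) * (4 * real (card (T W i)) - real (card (A i)))
     \<le> (if m (W \<union> T W i) = {} then 0 else g (W \<union> T W i, T W i, i))" if W: "W \<in> Pow X" and i: "i \<in> I" for W i
  proof -
    let ?T = "T W i" let ?m = "m (W \<union> T W i)"
    have Tm: "?T \<subseteq> ?m" and mA: "card ?m \<le> card (A i)" and mI: "?m \<in> A ` I"
      using frag_subset_smallest[OF i assms(2,3), where W=W] by (auto simp: T_def m_def)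
    have TA: "?T \<subseteq> A i - W" using frag_subset[OF i] T_def by metis
    show ?thesis
    proof (cases "?m = {}")
      case True
      then have "?T = {}" using Tm by auto
      then show ?thesis using True assms(4) by simp
    next
      case False
      \<comment> \<open>T is disjoint from W, so passing from W to Z = W \<union> T splits off a
        factor q^|T|, which joins 16^|T| in \<open>g\<close>.\<close>
      have "X - W = (X - (W \<union> ?T)) \<union> ?T" using TA assms(3)[OF i] by auto
      moreover have "finite ?T" using Tm finm[OF mI] finite_subset by auto
      ultimately have "card (X - W) = card (X - (W \<union> ?T)) + card ?T"
        using card_Un_disjoint[of "X - (W \<union> ?T)" ?T] assms(2) by auto
      then have e: "q ^ card (X - W) = q ^ card (X - (W \<union> ?T)) * q ^ card ?T" by (simp add: power_add)
      have "4 * real (card ?T) - real (card (A i)) \<le> 4 * real (card ?T) - real (card ?m)" using mA by simp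
      also have "\<dots> = real_of_int (4 * int (card ?T) - int (card ?m))" by simp
      also have "\<dots> \<le> 2 powr (4 * int (card ?T) - int (card ?m))" by (rule real_le_power2)
      also have "\<dots> = 2 powr (real (4 * card ?T)) / 2 powr (real (card ?m))" by (simp add: powr_diff)
      also have "\<dots> = 16 ^ card ?T / 2 ^ card ?m" 
        unfolding powr_realpow[OF zero_less_numeral] power_mult by simp
      finally have "q ^ card (X - W) * (4 * real (card ?T) - real (card (A i))) \<le>
          q ^ card (X - W) * (16 ^ card ?T / 2 ^ card ?m)"
        using assms(4) by (intro mult_left_mono) auto
      also have "\<dots> = g (W \<union> ?T, ?T, i)" unfolding g_def e by (simp add: power_mult_distrib)
      finally show ?thesis using False by simp
    qed
  qed
  have "(\<Sum>W\<in>Pow X. \<Sum>i\<in>I. q ^ card (X - W) * (4 * real (card (T W i)) - real (card (A i))))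
    \<le> (\<Sum>W\<in>Pow X. \<Sum>i\<in>I. if m (W \<union> T W i) = {} then 0 else g (W \<union> T W i, T W i, i))"
    by (intro sum_mono main)
  also have "\<dots> = (\<Sum>(W,i)\<in>Pow X \<times> I. if m (W \<union> T W i) = {} then 0 else g (W \<union> T W i, T W i, i))"
    by (simp add: sum.cartesian_product)
  also have "\<dots> = (\<Sum>(W,i)\<in>{(W,i)\<in>Pow X \<times> I. m (W \<union> T W i) \<noteq> {}}. g (W \<union> T W i, T W i, i))"
    using assms(1,2) by (intro sum.mono_neutral_cong_right) (auto split: if_splits)
  also have "\<dots> = sum g ((\<lambda>(W,i). (W \<union> T W i, T W i, i)) ` {(W,i)\<in>Pow X \<times> I. m (W \<union> T W i) \<noteq> {}})"
  proof (subst sum.reindex)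
    \<comment> \<open>The fragment is disjoint from W, so W is recovered as Z - T.\<close>
    show "inj_on (\<lambda>(W,i). (W \<union> T W i, T W i, i)) {(W,i)\<in>Pow X \<times> I. m (W \<union> T W i) \<noteq> {}}"
    proof (rule inj_onI)
      fix x y assume *: "x \<in> {(W,i)\<in>Pow X \<times> I. m (W \<union> T W i) \<noteq> {}}"
        and eq: "(\<lambda>(W,i). (W \<union> T W i, T W i, i)) x = (\<lambda>(W,i). (W \<union> T W i, T W i, i)) y"
      obtain W i W' where xy: "x = (W, i)" "y = (W', i)" using eq by (cases x, cases y) auto
      have "i \<in> I" using * xy by auto
      then have "T W i \<inter> W = {}" "T W' i \<inter> W' = {}"
        using frag_subset[OF \<open>i \<in> I\<close>, where A=A] unfolding T_def by blast+
      then show "x = y" using eq xy by auto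
    qed
  qed (auto intro!: sum.cong)
  also have "\<dots> \<le> sum g Q"
  proof (rule sum_mono2[OF finQ])
    show "(\<lambda>(W,i). (W \<union> T W i, T W i, i)) ` {(W,i)\<in>Pow X \<times> I. m (W \<union> T W i) \<noteq> {}} \<subseteq> Q"
    proof clarsimp
      fix W i assume W: "W \<subseteq> X" "i \<in> I" "m (W \<union> T W i) \<noteq> {}"
      show "(W \<union> T W i, T W i, i) \<in> Q"
        using frag_subset_smallest[OF W(2) assms(2,3), where W=W] frag_subset[OF W(2), where A=A and W=W] W assms(3)[OF W(2)]
        unfolding Q_def T_def m_def by auto
    qed
  qed (use g0 in auto)
  also have "\<dots> = (\<Sum>Z\<in>{Z\<in>Pow X. m Z \<in> A ` I \<and> m Z \<noteq> {}}. \<Sum>T\<in>Pow (m Z). \<Sum>i\<in>{i\<in>I. T \<subseteq> A i}. g (Z, T, i))"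
  proof -
    let ?Z = "{Z\<in>Pow X. m Z \<in> A ` I \<and> m Z \<noteq> {}}"
    have "(\<Sum>Z\<in>?Z. \<Sum>T\<in>Pow (m Z). \<Sum>i\<in>{i\<in>I. T \<subseteq> A i}. g (Z, T, i))
      = (\<Sum>Z\<in>?Z. \<Sum>(T, i)\<in>Sigma (Pow (m Z)) (\<lambda>T. {i\<in>I. T \<subseteq> A i}). g (Z, T, i))"
      using assms(1) finm by (intro sum.cong[OF refl] sum.Sigma) auto
    also have "\<dots> = (\<Sum>(Z, T, i)\<in>Q. g (Z, T, i))"
      unfolding Q_def using assms(1,2) finm by (subst sum.Sigma) (auto intro!: finite_SigmaI sum.cong)
    finally show ?thesis by simp
  qed
  also have "\<dots> \<le> (\<Sum>Z\<in>{Z\<in>Pow X. m Z \<in> A ` I \<and> m Z \<noteq> {}}. q ^ card (X - Z) * real (card I))"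
  proof (rule sum_mono, clarify)
    fix Z i assume Z: "Z \<subseteq> X" and i: "i \<in> I" "m Z = A i"
    then have "m Z \<in> A ` I" by auto
    then have mX': "m Z \<subseteq> X" and fm: "finite (m Z)" by (rule mX, rule finm)
    \<comment> \<open>The spread hypothesis bounds each of the 2^|m Z| terms, and their number
      cancels the denominator in \<open>g\<close>.\<close>
    have "(\<Sum>T\<in>Pow (m Z). \<Sum>i\<in>{i\<in>I. T \<subseteq> A i}. g (Z, T, i)) =
        (\<Sum>T\<in>Pow (m Z). q ^ card (X - Z) / 2 ^ card (m Z) * (real (card {i\<in>I. T \<subseteq> A i}) * (16 * q) ^ card T))"
      by (simp add: g_def mult_ac)
    also have "\<dots> \<le> (\<Sum>T\<in>Pow (m Z). q ^ card (X - Z) / 2 ^ card (m Z) * real (card I))"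
      using assms(4) mX' by (intro sum_mono mult_left_mono spread) auto
    also have "\<dots> = q ^ card (X - Z) * real (card I)" using fm by (simp add: card_Pow)
    finally show "(\<Sum>T\<in>Pow (m Z). \<Sum>i\<in>{i\<in>I. T \<subseteq> A i}. g (Z, T, i)) \<le> q ^ card (X - Z) * real (card I)" .
  qed
  \<comment> \<open>If some \<open>m Z\<close> in the range of summation is nonempty, then no member
    is empty, since an empty one would be smallest in every Z. Hence |I| is at most the sum of the
    sizes.\<close>
  also have "\<dots> \<le> (\<Sum>Z\<in>{Z\<in>Pow X. m Z \<in> A ` I \<and> m Z \<noteq> {}}. q ^ card (X - Z) * (\<Sum>i\<in>I. real (card (A i))))"
  proof (rule sum_mono, rule mult_left_mono)
    fix Z assume Z: "Z \<in> {Z\<in>Pow X. m Z \<in> A ` I \<and> m Z \<noteq> {}}"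
    have "card (A i) \<noteq> 0" if i: "i \<in> I" for i
    proof
      assume "card (A i) = 0"
      then have "A i = {}" using assms(2) assms(3)[OF i] finite_subset by (metis card_0_eq)
      then have "card (m Z) \<le> card (A i)"
        using smallest_cases[of i I A Z] i unfolding m_def by (metis empty_subsetI)
      then show False using Z finm \<open>card (A i) = 0\<close> by auto
    qed
    then have "(\<Sum>i\<in>I. 1) \<le> (\<Sum>i\<in>I. real (card (A i)))"
      by (intro sum_mono) (metis One_nat_def Suc_leI neq0_conv of_nat_1 of_nat_le_iff)
    then show "real (card I) \<le> (\<Sum>i\<in>I. real (card (A i)))" by simp
  qed (use assms(4) in auto)
  also have "\<dots> \<le> (\<Sum>Z\<in>Pow X. q ^ card (X - Z) * (\<Sum>i\<in>I. real (card (A i))))"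
    using assms(2,4) by (intro sum_mono2) (auto intro!: sum_nonneg mult_nonneg_nonneg)
  also have "\<dots> = (q + 1) ^ card X * (\<Sum>i\<in>I. real (card (A i)))"
    by (simp add: sum_powers_Pow[OF assms(2)] flip: sum_distrib_right)
  finally have fin: "(\<Sum>W\<in>Pow X. \<Sum>i\<in>I. q ^ card (X - W) * (4 * real (card (T W i)) - real (card (A i))))
    \<le> (q + 1) ^ card X * (\<Sum>i\<in>I. real (card (A i)))" .
  \<comment> \<open>Four times the weighted fragment sum is thus at most twice (q + 1)^|X| times the
    sum of the sizes, whence the factor 1/2. The weight 4 is the source of 16 = 2^4 in the spread
    condition.\<close>
  have "(\<Sum>W\<in>Pow X. \<Sum>i\<in>I. q ^ card (X - W) * (4 * real (card (T W i)) - real (card (A i))))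
    = 4 * (\<Sum>W\<in>Pow X. q ^ card (X - W) * (\<Sum>i\<in>I. real (card (T W i))))
      - (\<Sum>W\<in>Pow X. q ^ card (X - W)) * (\<Sum>i\<in>I. real (card (A i)))"
    by (simp add: right_diff_distrib sum_subtractf sum_distrib_left sum_distrib_right mult_ac)
  then show ?thesis using fin unfolding T_def sum_powers_Pow[OF assms(2)] by simp
qed

section \<open>Random colourings\<close>

text \<open>Induction on the reserved colours D: fixing the class W of one colour leaves a colouring of X - W
  by the others, and a fragment covered by D extends to a member covered by D and W.\<close>

lemma card_colourings_missing:
  fixes A :: "'i \<Rightarrow> 'a set" and C :: "'c set"
  assumes "finite D" "D \<subseteq> C" "finite C" "finite X" "finite I" "\<And>i. i \<in> I \<Longrightarrow> A i \<subseteq> X"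
    and "\<And>T. T \<subseteq> X \<Longrightarrow> real (card {i\<in>I. T \<subseteq> A i}) * (16 * real (card C - 1)) ^ card T \<le> real (card I)"
  shows "real (card {c \<in> X \<rightarrow>\<^sub>E C. \<forall>i\<in>I. \<not> A i \<subseteq> {x. c x \<in> D}}) * real (card I) * 2 ^ card D
    \<le> real (card C) ^ card X * (\<Sum>i\<in>I. real (card (A i)))"
  using assms
proof (induction D arbitrary: C X A rule: finite_induct)
  case empty
  \<comment> \<open>With no reserved colours only an empty member is covered. If there is one, no
    colouring is bad; otherwise every size is at least 1 and the trivial bound |C|^|X|
    suffices.\<close>
  have "real (card {c \<in> X \<rightarrow>\<^sub>E C. \<forall>i\<in>I. \<not> A i \<subseteq> {}}) * real (card I)
    \<le> real (card C) ^ card X * (\<Sum>i\<in>I. real (card (A i)))"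
  proof (cases "\<exists>i\<in>I. A i = {}")
    case False
    have "card {c \<in> X \<rightarrow>\<^sub>E C. \<forall>i\<in>I. \<not> A i \<subseteq> {}} \<le> card (X \<rightarrow>\<^sub>E C)"
      using empty by (intro card_mono) (auto intro: finite_PiE)
    then have "card {c \<in> X \<rightarrow>\<^sub>E C. \<forall>i\<in>I. \<not> A i \<subseteq> {}} \<le> card C ^ card X"
      using empty by (simp add: card_PiE)
    then have 1: "real (card {c \<in> X \<rightarrow>\<^sub>E C. \<forall>i\<in>I. \<not> A i \<subseteq> {}}) \<le> real (card C) ^ card X"
      by (simp flip: of_nat_power)
    have "1 \<le> real (card (A i))" if "i \<in> I" for i
      using that False empty.prems(3,5) finite_subset
      by (metis One_nat_def Suc_leI card_gt_0_iff of_nat_1 of_nat_le_iff)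
    then have "(\<Sum>i\<in>I. 1) \<le> (\<Sum>i\<in>I. real (card (A i)))" by (intro sum_mono)
    then show ?thesis using 1 by (intro mult_mono) auto
  next
    case True
    then have "{c \<in> X \<rightarrow>\<^sub>E C. \<forall>i\<in>I. \<not> A i \<subseteq> {}} = {}" by auto
    then show ?thesis by (simp only: card.empty) (auto intro!: mult_nonneg_nonneg sum_nonneg)
  qed
  then show ?case by simp
next
  case (insert j D)
  define bad where "bad W = {c \<in> (X - W) \<rightarrow>\<^sub>E (C - {j}). \<forall>i\<in>I. \<not> frag I A W i \<subseteq> {x. c x \<in> D}}" for W
  let ?B = "{c \<in> X \<rightarrow>\<^sub>E C. \<forall>i\<in>I. \<not> A i \<subseteq> {x. c x \<in> insert j D}}"
  \<comment> \<open>A colouring is split into the class W of colour j and the colouring of the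
    remaining points; the latter lies in \<open>bad W\<close> if the former colouring is
    bad.\<close>
  define h where "h c = ({x\<in>X. c x = j}, restrict c (X - {x\<in>X. c x = j}))" for c :: "'a \<Rightarrow> 'c"
  have jC: "j \<in> C" and D: "D \<subseteq> C - {j}" using insert.hyps(2) insert.prems(1) by auto
  have inj: "inj_on h ?B"
  proof (rule inj_onI)
    fix c c' assume c: "c \<in> ?B" "c' \<in> ?B" "h c = h c'"
    then have eq: "{x\<in>X. c x = j} = {x\<in>X. c' x = j}"
      "restrict c (X - {x\<in>X. c x = j}) = restrict c' (X - {x\<in>X. c x = j})" unfolding h_def by auto
    show "c = c'"
    proof (rule PiE_ext)
      show "c \<in> X \<rightarrow>\<^sub>E C" "c' \<in> X \<rightarrow>\<^sub>E C" using c by auto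
      fix x assume x: "x \<in> X"
      show "c x = c' x"
      proof (cases "c x = j")
        case True
        then have "x \<in> {x\<in>X. c' x = j}" using eq(1) x by blast
        then show ?thesis using True by simp
      next
        case False
        then show ?thesis using fun_cong[OF eq(2), of x] x by auto
      qed
    qed
  qed
  have sub: "h ` ?B \<subseteq> Sigma (Pow X) bad"
  proof (rule image_subsetI)
    fix c assume "c \<in> ?B"
    then have c: "c \<in> X \<rightarrow>\<^sub>E C" and cI: "\<forall>i\<in>I. \<not> A i \<subseteq> {x. c x \<in> insert j D}" by auto
    let ?W = "{x\<in>X. c x = j}"
    have "restrict c (X - ?W) \<in> bad ?W"
      unfolding bad_def
    proof (intro CollectI conjI ballI notI)
      show "restrict c (X - ?W) \<in> X - ?W \<rightarrow>\<^sub>E C - {j}" using c by auto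
      fix i assume i: "i \<in> I" and sub: "frag I A ?W i \<subseteq> {x. restrict c (X - ?W) x \<in> D}"
      obtain l where l: "l \<in> I" "frag I A ?W i = A l - ?W" by (rule frag_cases[OF i, of A ?W])
      have "A l \<subseteq> {x. c x \<in> insert j D}"
      proof
        fix x assume x: "x \<in> A l"
        then have "x \<in> X" using insert.prems(5)[OF l(1)] by auto
        then show "x \<in> {x. c x \<in> insert j D}" using x sub l(2) by (cases "c x = j") auto
      qed
      then show False using cI l by auto
    qed
    then show "h c \<in> Sigma (Pow X) bad" unfolding h_def by auto
  qed
  have finbad: "finite (bad W)" for W
    unfolding bad_def
    by (rule finite_subset[of _ "(X - W) \<rightarrow>\<^sub>E (C - {j})"]) (use insert.prems(2,3) in \<open>auto intro!: finite_PiE\<close>)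
  have "card ?B \<le> card (Sigma (Pow X) bad)"
    by (rule card_inj_on_le[OF inj sub]) (use insert.prems(3) finbad in auto)
  also have "\<dots> = (\<Sum>W\<in>Pow X. card (bad W))"
    using insert.prems(3) finbad by simp
  finally have "real (card ?B) \<le> real (\<Sum>W\<in>Pow X. card (bad W))" by (rule of_nat_mono)
  then have B: "real (card ?B) \<le> (\<Sum>W\<in>Pow X. real (card (bad W)))" by (simp only: of_nat_sum)
  \<comment> \<open>With this q, the weight q^|X - W| is exactly the number of colourings of X - W
    by the colours other than j, and q + 1 = |C|.\<close>
  let ?q = "real (card C - 1)"
  have IH: "real (card (bad W)) * real (card I) * 2 ^ card D
     \<le> ?q ^ card (X - W) * (\<Sum>i\<in>I. real (card (frag I A W i)))" if W: "W \<in> Pow X" for W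
  proof -
    have cC: "card (C - {j}) = card C - 1" using jC by simp
    have "real (card {c \<in> (X - W) \<rightarrow>\<^sub>E (C - {j}). \<forall>i\<in>I. \<not> frag I A W i \<subseteq> {x. c x \<in> D}}) * real (card I) * 2 ^ card D
      \<le> real (card (C - {j})) ^ card (X - W) * (\<Sum>i\<in>I. real (card (frag I A W i)))"
    proof (rule insert.IH[OF D])
      show "finite (C - {j})" "finite (X - W)" "finite I" using insert.prems(2-4) by auto
      show fX: "frag I A W i \<subseteq> X - W" if "i \<in> I" for i
        using frag_subset[OF that, of A W] insert.prems(5)[OF that] by auto
      fix T assume T: "T \<subseteq> X - W"
      have "real (card {i\<in>I. T \<subseteq> frag I A W i}) * (16 * real (card (C - {j}) - 1)) ^ card T
        \<le> real (card {i\<in>I. T \<subseteq> A i}) * (16 * real (card C - 1)) ^ card T"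
      proof (intro mult_mono power_mono)
        have "{i\<in>I. T \<subseteq> frag I A W i} \<subseteq> {i\<in>I. T \<subseteq> A i}"
          using frag_subset[where I=I and A=A and W=W] by blast
        then show "real (card {i\<in>I. T \<subseteq> frag I A W i}) \<le> real (card {i\<in>I. T \<subseteq> A i})"
          using insert.prems(4) by (auto intro!: card_mono)
      qed (use cC in auto)
      also have "\<dots> \<le> real (card I)" using T by (intro insert.prems(6)) auto
      finally show "real (card {i\<in>I. T \<subseteq> frag I A W i}) * (16 * real (card (C - {j}) - 1)) ^ card T \<le> real (card I)" .
    qed
    then show ?thesis unfolding bad_def cC .
  qed
  have "real (card ?B) * real (card I) * 2 ^ card D \<le> (\<Sum>W\<in>Pow X. real (card (bad W))) * real (card I) * 2 ^ card D"
    using B by (intro mult_right_mono) auto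
  also have "\<dots> = (\<Sum>W\<in>Pow X. real (card (bad W)) * real (card I) * 2 ^ card D)"
    by (simp add: sum_distrib_right)
  also have "\<dots> \<le> (\<Sum>W\<in>Pow X. ?q ^ card (X - W) * (\<Sum>i\<in>I. real (card (frag I A W i))))"
    by (rule sum_mono[OF IH])
  also have "\<dots> \<le> (?q + 1) ^ card X * (\<Sum>i\<in>I. real (card (A i))) / 2"
    by (rule sum_card_frag_le[OF insert.prems(4,3,5) _ insert.prems(6)]) auto
  also have "?q + 1 = real (card C)"
    using jC insert.prems(2) by (metis One_nat_def Suc_pred card_gt_0_iff empty_iff of_nat_Suc add.commute)
  finally show ?case using insert.hyps by simp
qed

text \<open>A union bound: by \<open>card_colourings_missing\<close>, a random colouring fails for a
  given j with probability at most k / 2^b, and |J| k < 2^b. Sets covered by different reserved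
  colours are disjoint. The sets \<open>A j i\<close> are indexed so that parts of members can be
  matched while the members themselves are remembered.\<close>

lemma rainbow_matching_of_spread:
  fixes A :: "'j \<Rightarrow> 'i \<Rightarrow> 'a set" and G :: "'j \<Rightarrow> 'i set" and k b :: nat
  assumes "finite X" "finite J" "0 < b" "card J * k < 2 ^ b"
    and G: "\<And>j. j \<in> J \<Longrightarrow> finite (G j)" "\<And>j. j \<in> J \<Longrightarrow> G j \<noteq> {}"
    and A: "\<And>j i. j \<in> J \<Longrightarrow> i \<in> G j \<Longrightarrow> A j i \<subseteq> X" "\<And>j i. j \<in> J \<Longrightarrow> i \<in> G j \<Longrightarrow> card (A j i) \<le> k"
    and spread: "\<And>j T. j \<in> J \<Longrightarrow> T \<subseteq> X \<Longrightarrow>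
      real (card {i\<in>G j. T \<subseteq> A j i}) * (16 * real (card J * b - 1)) ^ card T \<le> real (card (G j))"
  shows "\<exists>F. (\<forall>j\<in>J. F j \<in> G j) \<and> disjoint_family_on (\<lambda>j. A j (F j)) J"
proof (cases "J = {}")
  case True then show ?thesis by (simp add: disjoint_family_on_def)
next
  case False
  define C where "C = J \<times> {..<b}"
  define D where "D j = {j} \<times> {..<b}" for j :: 'j
  define bad where "bad j = {c \<in> X \<rightarrow>\<^sub>E C. \<forall>i\<in>G j. \<not> A j i \<subseteq> {x. c x \<in> D j}}" for j
  have cC: "card C = card J * b" by (simp add: C_def card_cartesian_product)
  have finC: "finite C" using assms by (simp add: C_def)
  let ?N = "real (card C) ^ card X"
  have Npos: "?N > 0" using False assms cC by (simp add: card_gt_0_iff)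
  have b: "real (card (bad j)) * 2 ^ b \<le> ?N * real k" if j: "j \<in> J" for j
  proof -
    have "card (D j) = b" by (simp add: D_def card_cartesian_product)
    then have "real (card (bad j)) * real (card (G j)) * 2 ^ b \<le> ?N * (\<Sum>i\<in>G j. real (card (A j i)))"
      using card_colourings_missing[of "D j" C X "G j" "A j"] j assms finC cC
      unfolding bad_def by (auto simp: D_def C_def)
    also have "\<dots> \<le> ?N * (real (card (G j)) * real k)"
      using sum_bounded_above[of "G j" "\<lambda>i. real (card (A j i))" "real k"] A(2)[OF j]
      by (intro mult_left_mono) auto
    finally have "(real (card (bad j)) * 2 ^ b) * real (card (G j)) \<le> (?N * real k) * real (card (G j))"
      by (simp add: mult_ac)
    moreover have "real (card (G j)) > 0" using G[OF j] by (simp add: card_gt_0_iff)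
    ultimately show ?thesis by (rule mult_right_le_imp_le)
  qed
  have finbad: "finite (bad j)" for j unfolding bad_def
    by (rule finite_subset[of _ "X \<rightarrow>\<^sub>E C"]) (use assms(1) finC in \<open>auto intro!: finite_PiE\<close>)
  have "real (card (\<Union>j\<in>J. bad j)) * 2 ^ b \<le> (\<Sum>j\<in>J. real (card (bad j))) * 2 ^ b"
    using card_UN_le[OF assms(2), of bad] by (intro mult_right_mono) (auto simp flip: of_nat_sum)
  also have "\<dots> = (\<Sum>j\<in>J. real (card (bad j)) * 2 ^ b)" by (simp add: sum_distrib_right)
  also have "\<dots> \<le> (\<Sum>j\<in>J. ?N * real k)" by (rule sum_mono[OF b])
  also have "\<dots> = ?N * real (card J * k)" by simp
  also have "\<dots> < ?N * real (2 ^ b)" using Npos assms(4) by (intro mult_strict_left_mono of_nat_less_iff[THEN iffD2])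
  finally have "real (card (\<Union>j\<in>J. bad j)) < ?N" by simp
  then have "card (\<Union>j\<in>J. bad j) < card (X \<rightarrow>\<^sub>E C)" using assms(1) by (simp add: card_PiE flip: of_nat_power)
  then have "\<not> (X \<rightarrow>\<^sub>E C) \<subseteq> (\<Union>j\<in>J. bad j)"
    using card_mono[of "\<Union>j\<in>J. bad j"] assms(2) finbad by (meson finite_UN not_le)
  then obtain c where c: "c \<in> X \<rightarrow>\<^sub>E C" "\<And>j. j \<in> J \<Longrightarrow> c \<notin> bad j" by auto
  then have "\<forall>j\<in>J. \<exists>i\<in>G j. A j i \<subseteq> {x. c x \<in> D j}" unfolding bad_def by auto
  then obtain F where F: "\<And>j. j \<in> J \<Longrightarrow> F j \<in> G j \<and> A j (F j) \<subseteq> {x. c x \<in> D j}" by metis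
  have "disjoint_family_on (\<lambda>j. A j (F j)) J"
    unfolding disjoint_family_on_def
  proof (intro ballI impI equals0I)
    fix i j x assume "i \<in> J" "j \<in> J" "i \<noteq> j" "x \<in> A i (F i) \<inter> A j (F j)"
    then have "c x \<in> D i" "c x \<in> D j" using F by auto
    then show False using \<open>i \<noteq> j\<close> by (auto simp: D_def)
  qed
  then show ?thesis using F by auto
qed

section \<open>Spread subfamilies\<close>

text \<open>The inequality alone would hold for the empty family, hence the clause on
  non-emptiness.\<close>

definition spread_above :: "real \<Rightarrow> 'a set set \<Rightarrow> 'a set \<Rightarrow> bool" where
  "spread_above \<kappa> G S \<longleftrightarrow> finite G \<and> G \<noteq> {} \<and> (\<forall>B\<in>G. S \<subseteq> B) \<and>
    (\<forall>T. finite T \<longrightarrow> T \<inter> S = {} \<longrightarrow> real (card {B\<in>G. T \<subseteq> B}) * \<kappa> ^ card T \<le> real (card G))"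

lemma exists_spread_above:
  fixes H :: "'a set set"
  assumes "finite H" "H \<noteq> {}" "\<And>B. B \<in> H \<Longrightarrow> finite B" "0 < \<kappa>"
  obtains S where "finite S" "spread_above \<kappa> {B\<in>H. S \<subseteq> B} S"
    "real (card H) \<le> real (card {B\<in>H. S \<subseteq> B}) * \<kappa> ^ card S"
proof -
  \<comment> \<open>A maximiser of f works: maximality against S \<union> T is spreadness, against {} the size bound.\<close>
  define f where "f S = real (card {B\<in>H. S \<subseteq> B}) * \<kappa> ^ card S" for S
  have fin: "finite (\<Union>H)" using assms by auto
  have "Max (f ` Pow (\<Union>H)) \<in> f ` Pow (\<Union>H)" using fin by (intro Max_in) auto
  then obtain S where "S \<subseteq> \<Union>H" "f S = Max (f ` Pow (\<Union>H))" by auto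
  then have S: "S \<subseteq> \<Union>H" "\<And>T. T \<subseteq> \<Union>H \<Longrightarrow> f T \<le> f S" using fin by auto
  let ?G = "{B\<in>H. S \<subseteq> B}"
  have finS: "finite S" using S(1) fin finite_subset by auto
  have "f {} = real (card H)" by (simp add: f_def)
  then have H: "real (card H) \<le> f S" using S(2)[of "{}"] by simp
  have "card H > 0" using assms by (simp add: card_gt_0_iff)
  with H have "?G \<noteq> {}" unfolding f_def by (metis card.empty mult_zero_left not_le of_nat_0 of_nat_0_less_iff)
  moreover have "real (card {B\<in>?G. T \<subseteq> B}) * \<kappa> ^ card T \<le> real (card ?G)"
    if T: "finite T" "T \<inter> S = {}" for T
  proof (cases "{B\<in>?G. T \<subseteq> B} = {}")
    case True then show ?thesis by (simp only: card.empty)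
  next
    case False
    then have "S \<union> T \<subseteq> \<Union>H" by blast
    moreover have "{B\<in>?G. T \<subseteq> B} = {B\<in>H. S \<union> T \<subseteq> B}" by auto
    moreover have "card (S \<union> T) = card S + card T" using T finS by (simp add: card_Un_disjoint Int_commute)
    ultimately have "(real (card {B\<in>?G. T \<subseteq> B}) * \<kappa> ^ card T) * \<kappa> ^ card S \<le> real (card ?G) * \<kappa> ^ card S"
      using S(2)[of "S \<union> T"] by (simp add: f_def power_add mult_ac)
    then show ?thesis using assms(4) by simp
  qed
  ultimately have "spread_above \<kappa> ?G S" using assms(1) unfolding spread_above_def by auto
  then show thesis using that finS H unfolding f_def by blast
qed

text \<open>Each point of U lies in at most a fraction 1/\<kappa> of G, so at least a fraction
  (\<kappa> - |U|)/\<kappa> \<ge> R/\<kappa> of the members avoid U. For nonempty T, this loss is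
  absorbed by weakening \<kappa>^|T| to R^|T|: one factor R pays for the discarded members, and R
  \<le> \<kappa> handles the others.\<close>

lemma spread_above_avoiding:
  assumes G: "spread_above \<kappa> G S" and U: "finite U" "U \<inter> S = {}"
    and R: "0 \<le> R" "R + real (card U) \<le> \<kappa>" "0 < \<kappa>"
    and T: "finite T" "T \<inter> S = {}"
  shows "real (card {B\<in>G. B \<inter> U = {} \<and> T \<subseteq> B}) * R ^ card T \<le> real (card {B\<in>G. B \<inter> U = {}})"
    and "real (card G) * R \<le> real (card {B\<in>G. B \<inter> U = {}}) * \<kappa>"
proof -
  let ?G = "{B\<in>G. B \<inter> U = {}}"
  have finG: "finite G" and spr: "\<And>T. finite T \<Longrightarrow> T \<inter> S = {} \<Longrightarrow> real (card {B\<in>G. T \<subseteq> B}) * \<kappa> ^ card T \<le> real (card G)"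
    using G unfolding spread_above_def by auto
  have "G = ?G \<union> (\<Union>x\<in>U. {B\<in>G. {x} \<subseteq> B})" by auto
  then have "card G \<le> card ?G + card (\<Union>x\<in>U. {B\<in>G. {x} \<subseteq> B})" 
    by (rule ord_eq_le_trans[OF arg_cong[where f=card] card_Un_le])
  also have "\<dots> \<le> card ?G + (\<Sum>x\<in>U. card {B\<in>G. {x} \<subseteq> B})" using card_UN_le[OF U(1)] by simp
  finally have "real (card G) \<le> real (card ?G + (\<Sum>x\<in>U. card {B\<in>G. {x} \<subseteq> B}))"
    by (rule of_nat_mono)
  then have "real (card G) \<le> real (card ?G) + (\<Sum>x\<in>U. real (card {B\<in>G. {x} \<subseteq> B}))"
    by (simp only: of_nat_add of_nat_sum)
  then have "real (card G) * \<kappa> \<le> real (card ?G) * \<kappa> + (\<Sum>x\<in>U. real (card {B\<in>G. {x} \<subseteq> B}) * \<kappa>)"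
    using R(3) by (simp flip: sum_distrib_right distrib_right)
  also have "\<dots> \<le> real (card ?G) * \<kappa> + (\<Sum>x\<in>U. real (card G))"
  proof (intro add_left_mono sum_mono)
    fix x assume "x \<in> U"
    then show "real (card {B\<in>G. {x} \<subseteq> B}) * \<kappa> \<le> real (card G)"
      using spr[of "{x}"] U(2) by auto
  qed
  finally have "real (card G) * (\<kappa> - real (card U)) \<le> real (card ?G) * \<kappa>" by (simp add: algebra_simps)
  moreover have "real (card G) * R \<le> real (card G) * (\<kappa> - real (card U))"
    using R by (intro mult_left_mono) auto
  ultimately show 2: "real (card G) * R \<le> real (card ?G) * \<kappa>" by linarith
  show "real (card {B\<in>G. B \<inter> U = {} \<and> T \<subseteq> B}) * R ^ card T \<le> real (card ?G)"
  proof (cases "T = {}")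
    case False
    then obtain t where t: "card T = Suc t" using T(1) by (metis card_eq_0_iff not0_implies_Suc)
    have "real (card {B\<in>G. B \<inter> U = {} \<and> T \<subseteq> B}) * R ^ card T * \<kappa>
      \<le> real (card {B\<in>G. T \<subseteq> B}) * (\<kappa> ^ t * R) * \<kappa>"
    proof (intro mult_right_mono mult_mono)
      show "real (card {B\<in>G. B \<inter> U = {} \<and> T \<subseteq> B}) \<le> real (card {B\<in>G. T \<subseteq> B})"
        using finG by (auto intro!: card_mono)
      have "R ^ t \<le> \<kappa> ^ t" using R by (intro power_mono) auto
      then show "R ^ card T \<le> \<kappa> ^ t * R" using R t by (simp add: mult.commute mult_left_mono)
    qed (use R in auto)
    also have "\<dots> = (real (card {B\<in>G. T \<subseteq> B}) * \<kappa> ^ card T) * R" using t by simp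
    also have "\<dots> \<le> real (card G) * R" using spr[OF T] R by (intro mult_right_mono) auto
    also note 2
    finally show ?thesis using R by simp
  qed simp
qed

section \<open>Disjoint sets of size at most two\<close>

text \<open>The sets \<open>P j\<close> are placeholders, replaced one at a time. The current family
  stays disjoint throughout, so the union U of the other sets misses \<open>P i\<close> and has at
  most (|J| - 1) m points, as \<open>ext\<close> requires.\<close>

lemma extend_to_disjoint_family:
  assumes "finite J"
    and init: "\<And>j. j \<in> J \<Longrightarrow> finite (P j) \<and> card (P j) \<le> m" "disjoint_family_on P J"
    and \<S>: "\<And>j S. j \<in> J \<Longrightarrow> S \<in> \<S> j \<Longrightarrow> finite S \<and> card S \<le> m"
    and ext: "\<And>j U. j \<in> J \<Longrightarrow> finite U \<Longrightarrow> card U \<le> (card J - 1) * m \<Longrightarrow> U \<inter> P j = {} \<Longrightarrow>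
      \<exists>S\<in>\<S> j. P j \<subseteq> S \<and> S \<inter> U = {}"
  shows "\<exists>F. (\<forall>j\<in>J. F j \<in> \<S> j) \<and> disjoint_family_on F J"
proof -
  have "\<exists>F. (\<forall>j\<in>I. F j \<in> \<S> j) \<and> (\<forall>j\<in>J - I. F j = P j) \<and> disjoint_family_on F J"
    if "I \<subseteq> J" for I
    using finite_subset[OF that assms(1)] that
  proof (induction I rule: finite_induct)
    case empty
    then show ?case using init(2) by auto
  next
    case (insert i I)
    then obtain F where F: "\<forall>j\<in>I. F j \<in> \<S> j" "\<forall>j\<in>J - I. F j = P j" and dis: "disjoint_family_on F J" by auto
    have i: "i \<in> J" "i \<notin> I" using insert by auto
    define U where "U = (\<Union>j\<in>J - {i}. F j)"
    have Fj: "finite (F j) \<and> card (F j) \<le> m" if "j \<in> J" for j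
      using F \<S> init(1) that insert.prems by (cases "j \<in> I") auto
    have "card U \<le> (\<Sum>j\<in>J - {i}. card (F j))" unfolding U_def using assms(1) by (intro card_UN_le) auto
    also have "\<dots> \<le> (\<Sum>j\<in>J - {i}. m)" using Fj by (intro sum_mono) auto
    also have "\<dots> = (card J - 1) * m" using i by simp
    finally have cU: "card U \<le> (card J - 1) * m" .
    have "F j \<inter> F i = {}" if "j \<in> J - {i}" for j
      using dis that i(1) unfolding disjoint_family_on_def by blast
    then have "U \<inter> P i = {}" using F(2) i unfolding U_def by auto
    moreover have "finite U" unfolding U_def using assms(1) Fj by auto
    ultimately obtain S where S: "S \<in> \<S> i" "S \<inter> U = {}" using ext[OF i(1) _ cU] by blast
    have "F j \<inter> S = {}" if "j \<in> J - {i}" for j using S(2) that unfolding U_def by blast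
    then have "disjoint_family_on (F(i := S)) J"
      using dis unfolding disjoint_family_on_def by auto
    then show ?case using S(1) F i by (intro exI[of _ "F(i := S)"]) (auto simp: fun_upd_def)
  qed
  from this[of J] show ?thesis by auto
qed

text \<open>Greedy choice in increasing order: at index i at most i - 1 values are taken. This is
  the origin of the term (i-1) n^(k-1).\<close>

lemma distinct_representatives:
  fixes V :: "nat \<Rightarrow> 'a set"
  assumes "I \<subseteq> {1..s}" "\<And>i. i \<in> I \<Longrightarrow> i \<le> card (V i)"
  shows "\<exists>v. (\<forall>i\<in>I. v i \<in> V i) \<and> inj_on v I"
  using assms
proof (induction s arbitrary: I)
  case 0
  then show ?case by auto
next
  case (Suc s)
  have "I - {Suc s} \<subseteq> {1..s}" using Suc.prems(1) by (auto simp: le_Suc_eq)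
  with Suc.IH[of "I - {Suc s}"] Suc.prems obtain v
    where v: "\<forall>i\<in>I - {Suc s}. v i \<in> V i" "inj_on v (I - {Suc s})" by auto
  show ?case
  proof (cases "Suc s \<in> I")
    case False then show ?thesis using v by auto
  next
    case True
    have "card (v ` (I - {Suc s})) \<le> card (I - {Suc s})" 
      using \<open>I - {Suc s} \<subseteq> {1..s}\<close> by (meson card_image_le finite_atLeastAtMost finite_subset)
    also have "\<dots> \<le> s" using card_mono[OF _ \<open>I - {Suc s} \<subseteq> {1..s}\<close>] by simp
    also have "s < card (V (Suc s))" using Suc.prems(2)[OF True] by simp
    finally have "\<not> V (Suc s) \<subseteq> v ` (I - {Suc s})"
      using \<open>I - {Suc s} \<subseteq> {1..s}\<close> by (meson card_mono finite_atLeastAtMost finite_imageI finite_subset not_le)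
    then obtain w where w: "w \<in> V (Suc s)" "w \<notin> v ` (I - {Suc s})" by auto
    have "inj_on (v(Suc s := w)) I"
      using v(2) w(2) unfolding inj_on_def by (metis Diff_iff fun_upd_apply image_eqI singletonD)
    then show ?thesis using v(1) w(1) by (intro exI[of _ "v(Suc s := w)"]) (auto simp: fun_upd_def)
  qed
qed

text \<open>A heavy vertex v is as good as a singleton: whatever d further points are occupied, some set of the
  collection contains v and avoids them.\<close>

definition heavy :: "nat \<Rightarrow> 'a set \<Rightarrow> 'a set set \<Rightarrow> 'a set" where
  "heavy d X \<S> = {v\<in>X. {v} \<in> \<S> \<or> d < card {w\<in>X. w \<noteq> v \<and> {v, w} \<in> \<S>}}"

definition light_pairs :: "nat \<Rightarrow> 'a set \<Rightarrow> 'a set set \<Rightarrow> 'a set set" where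
  "light_pairs d X \<S> = {S\<in>\<S>. card S = 2 \<and> S \<inter> heavy d X \<S> = {}}"

lemma heavy_extend:
  assumes "v \<in> heavy d X \<S>" "finite U" "card U \<le> d" "v \<notin> U"
  shows "\<exists>S\<in>\<S>. v \<in> S \<and> S \<inter> U = {}"
proof (cases "{v} \<in> \<S>")
  case True then show ?thesis using assms by auto
next
  case False
  then have "card U < card {w\<in>X. w \<noteq> v \<and> {v, w} \<in> \<S>}" using assms unfolding heavy_def by auto
  then have "\<not> {w\<in>X. w \<noteq> v \<and> {v, w} \<in> \<S>} \<subseteq> U" using assms(2) by (meson card_mono not_le)
  then show ?thesis using assms(4) by auto
qed

text \<open>A point that is not heavy lies in at most d light pairs, so U meets at most d^2 of them.
  With d = 2(s-1) this is the coefficient 4(s-1)^2.\<close>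

lemma light_pairs_avoid:
  assumes X: "finite X" "\<And>S. S \<in> \<S> \<Longrightarrow> S \<subseteq> X" and U: "finite U" "card U \<le> d"
    and P: "d\<^sup>2 < card (light_pairs d X \<S>)"
  shows "\<exists>S\<in>\<S>. S \<inter> U = {}"
proof (rule ccontr)
  let ?P = "light_pairs d X \<S>"
  assume "\<not> ?thesis"
  then have "?P \<subseteq> (\<Union>u\<in>U. {S\<in>?P. u \<in> S})" unfolding light_pairs_def by auto
  moreover have finP: "finite ?P"
    using P by (intro card_ge_0_finite) simp
  ultimately have "card ?P \<le> card (\<Union>u\<in>U. {S\<in>?P. u \<in> S})" using U by (intro card_mono) auto
  also have "\<dots> \<le> (\<Sum>u\<in>U. card {S\<in>?P. u \<in> S})" using U by (intro card_UN_le)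
  also have "\<dots> \<le> (\<Sum>u\<in>U. d)"
  proof (rule sum_mono)
    fix u
    show "card {S\<in>?P. u \<in> S} \<le> d"
    proof (cases "{S\<in>?P. u \<in> S} = {}")
      case True then show ?thesis by (simp only: card.empty)
    next
      case False
      then have u: "u \<in> X" "u \<notin> heavy d X \<S>" using X unfolding light_pairs_def by auto
      let ?N = "{w\<in>X. w \<noteq> u \<and> {u, w} \<in> \<S>}"
      have "{S\<in>?P. u \<in> S} \<subseteq> (\<lambda>w. {u, w}) ` ?N"
      proof clarify
        fix S assume S: "S \<in> ?P" "u \<in> S"
        then have SS: "S \<in> \<S>" "card S = 2" unfolding light_pairs_def by auto
        then obtain w where "S = {u, w}" "w \<noteq> u" using S(2) by (auto simp: card_2_iff doubleton_eq_iff)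
        then show "S \<in> (\<lambda>w. {u, w}) ` ?N" using SS X(2)[OF SS(1)] by auto
      qed
      then have "card {S\<in>?P. u \<in> S} \<le> card ?N"
        using X(1) by (intro surj_card_le) auto
      also have "\<dots> \<le> d" using u unfolding heavy_def by auto
      finally show ?thesis .
    qed
  qed
  also have "\<dots> \<le> d\<^sup>2" using U by (simp add: power2_eq_square)
  finally show False using P by simp
qed

text \<open>The other s - 1 sets occupy at most d points. Indices with enough heavy vertices first
  reserve distinct ones as placeholders; the others start from the empty set and later use {} or a
  light pair.\<close>

lemma disjoint_small_sets:
  fixes \<S> :: "nat \<Rightarrow> 'a set set"
  assumes "finite X" "d = 2 * (s - 1)"
    and \<S>: "\<And>i S. i \<in> {1..s} \<Longrightarrow> S \<in> \<S> i \<Longrightarrow> S \<subseteq> X \<and> card S \<le> 2"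
    and rich: "\<And>i. i \<in> {1..s} \<Longrightarrow> {} \<in> \<S> i \<or> i \<le> card (heavy d X (\<S> i)) \<or> d\<^sup>2 < card (light_pairs d X (\<S> i))"
  shows "\<exists>F. (\<forall>i\<in>{1..s}. F i \<in> \<S> i) \<and> disjoint_family_on F {1..s}"
proof -
  define I where "I = {i\<in>{1..s}. i \<le> card (heavy d X (\<S> i))}"
  have "I \<subseteq> {1..s}" "\<And>i. i \<in> I \<Longrightarrow> i \<le> card (heavy d X (\<S> i))" unfolding I_def by auto
  from distinct_representatives[OF this] obtain v
    where v: "\<And>i. i \<in> I \<Longrightarrow> v i \<in> heavy d X (\<S> i)" "inj_on v I" by auto
  define P where "P i = (if i \<in> I then {v i} else {})" for i
  show ?thesis
  proof (rule extend_to_disjoint_family[where P=P and m=2])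
    show "disjoint_family_on P {1..s}"
      using v(2) unfolding P_def disjoint_family_on_def inj_on_def by auto
    show "finite S \<and> card S \<le> 2" if "i \<in> {1..s}" "S \<in> \<S> i" for i S
      using \<S>[OF that] assms(1) finite_subset by auto
    fix i U assume i: "i \<in> {1..s}" and U: "finite (U :: 'a set)" "card U \<le> (card {1..s} - 1) * 2" "U \<inter> P i = {}"
    then have d: "card U \<le> d" using assms(2) by simp
    show "\<exists>S\<in>\<S> i. P i \<subseteq> S \<and> S \<inter> U = {}"
    proof (cases "i \<in> I")
      case True
      then show ?thesis using heavy_extend[OF v(1)[OF True] U(1) d] U(3) unfolding P_def by auto
    next
      case False
      then have "{} \<in> \<S> i \<or> d\<^sup>2 < card (light_pairs d X (\<S> i))" using rich[OF i] i unfolding I_def by auto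
      moreover have "P i = {}" using False by (simp add: P_def)
      ultimately show ?thesis using light_pairs_avoid[OF assms(1) _ U(1) d, of "\<S> i"] \<S>[OF i] by auto
    qed
  qed (auto simp: P_def)
qed

section \<open>Families of tuples\<close>

lemma inj_on_tuple_set: "inj_on (tuple_set k) (tuples n k)"
proof (rule inj_onI)
  fix x y assume xy: "x \<in> tuples n k" "y \<in> tuples n k" "tuple_set k x = tuple_set k y"
  show "x = y"
  proof (rule PiE_ext)
    show "x \<in> {1..k} \<rightarrow>\<^sub>E {1..n}" "y \<in> {1..k} \<rightarrow>\<^sub>E {1..n}" using xy unfolding tuples_def by auto
    fix j assume "j \<in> {1..k}"
    then have "(j, x j) \<in> tuple_set k y" using xy(3) unfolding tuple_set_def by blast
    then show "x j = y j" unfolding tuple_set_def by auto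
  qed
qed

lemma finite_tuples: "finite (tuples n k)"
  unfolding tuples_def by (rule finite_PiE) auto

lemma tuple_set_subset: "x \<in> tuples n k \<Longrightarrow> tuple_set k x \<subseteq> {1..k} \<times> {1..n}"
  unfolding tuples_def tuple_set_def by (auto simp: PiE_iff)

lemma card_tuple_set: "card (tuple_set k x) = k"
proof -
  have "tuple_set k x = (\<lambda>j. (j, x j)) ` {1..k}" unfolding tuple_set_def by auto
  then show ?thesis by (simp add: card_image inj_on_def)
qed

text \<open>A tuple containing T is prescribed on |T| coordinates and hence determined by the
  remaining ones. The exponent is an integer since k < |T| is possible; the left side is then
  0.\<close>

lemma card_tuple_sets_containing:
  assumes "0 < n"
  shows "real (card {B \<in> tuple_set k ` tuples n k. T \<subseteq> B}) \<le> real n powi (int k - int (card T))"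
proof (cases "{B \<in> tuple_set k ` tuples n k. T \<subseteq> B} = {}")
  case True
  then show ?thesis by (simp only: card.empty) simp
next
  case False
  then obtain x0 where x0: "T \<subseteq> tuple_set k x0" by auto
  let ?Y = "{x \<in> tuples n k. T \<subseteq> tuple_set k x}"
  let ?K = "fst ` T"
  have K: "?K \<subseteq> {1..k}" using x0 unfolding tuple_set_def by auto
  have "inj_on fst (tuple_set k x0)" unfolding tuple_set_def inj_on_def by auto
  then have "inj_on fst T" using x0 by (rule inj_on_subset)
  then have cK: "card ?K = card T" by (rule card_image)
  then have Tk: "card T \<le> k" using card_mono[OF _ K] by simp
  have "{B \<in> tuple_set k ` tuples n k. T \<subseteq> B} = tuple_set k ` ?Y" by auto
  then have "card {B \<in> tuple_set k ` tuples n k. T \<subseteq> B} \<le> card ?Y"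
    using finite_tuples[of n k] by (simp add: card_image_le)
  also have "\<dots> \<le> card (({1..k} - ?K) \<rightarrow>\<^sub>E {1..n})"
  proof (rule card_inj_on_le)
    show "inj_on (\<lambda>x. restrict x ({1..k} - ?K)) ?Y"
    proof (rule inj_onI)
      fix x y assume xy: "x \<in> ?Y" "y \<in> ?Y" "restrict x ({1..k} - ?K) = restrict y ({1..k} - ?K)"
      show "x = y"
      proof (rule PiE_ext)
        show "x \<in> {1..k} \<rightarrow>\<^sub>E {1..n}" "y \<in> {1..k} \<rightarrow>\<^sub>E {1..n}" using xy unfolding tuples_def by auto
        fix j assume j: "j \<in> {1..k}"
        show "x j = y j"
        proof (cases "j \<in> ?K")
          case True
          then obtain v where "(j, v) \<in> T" by auto
          then have "(j, v) \<in> tuple_set k x" "(j, v) \<in> tuple_set k y" using xy by auto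
          then show ?thesis unfolding tuple_set_def by auto
        next
          case False
          then show ?thesis using fun_cong[OF xy(3), of j] j by simp
        qed
      qed
    qed
    show "(\<lambda>x. restrict x ({1..k} - ?K)) ` ?Y \<subseteq> ({1..k} - ?K) \<rightarrow>\<^sub>E {1..n}"
      unfolding tuples_def
      by (intro image_subsetI, unfold restrict_PiE_iff) (auto dest: PiE_mem)
    show "finite (({1..k} - ?K) \<rightarrow>\<^sub>E {1..n})" by (rule finite_PiE) auto
  qed
  also have "\<dots> = n ^ (k - card T)"
    using card_Diff_subset[OF finite_subset[OF K] K] cK by (simp add: card_PiE)
  finally have "real (card {B \<in> tuple_set k ` tuples n k. T \<subseteq> B}) \<le> real (n ^ (k - card T))"
    by (rule of_nat_mono)
  also have "\<dots> = real n powi (int (k - card T))" by simp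
  finally show ?thesis using Tk by (simp only: of_nat_diff)
qed

text \<open>The set S given by \<open>exists_spread_above\<close> satisfies |H| \<le> n^(k-|S|)
  \<kappa>^|S|. As |S| \<ge> 3 and \<kappa> \<le> n, all but three factors \<kappa> may be replaced
  by n.\<close>

lemma card_le_of_spread_above_large:
  assumes "0 < n" "H \<subseteq> tuple_set k ` tuples n k" "0 < \<kappa>" "\<kappa> \<le> real n"
    and large: "\<And>G S. G \<subseteq> H \<Longrightarrow> spread_above \<kappa> G S \<Longrightarrow> 3 \<le> card S"
  shows "real (card H) \<le> \<kappa> ^ 3 * real n powi (int k - 3)"
proof (cases "H = {}")
  case True
  then show ?thesis using assms(3) by simp
next
  case False
  have finH: "finite H" by (rule finite_subset[OF assms(2)]) (simp add: finite_tuples)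
  have "finite B" if "B \<in> H" for B
  proof -
    have "B \<subseteq> {1..k} \<times> {1..n}" using that assms(2) tuple_set_subset by fast
    then show ?thesis by (rule finite_subset) simp
  qed
  from exists_spread_above[OF finH False this assms(3)] obtain S
    where S: "spread_above \<kappa> {B\<in>H. S \<subseteq> B} S" "real (card H) \<le> real (card {B\<in>H. S \<subseteq> B}) * \<kappa> ^ card S"
    by blast
  have "3 \<le> card S" by (rule large[OF _ S(1)]) auto
  then obtain t where t: "card S = 3 + t" by (metis le_iff_add)
  have "card {B\<in>H. S \<subseteq> B} \<le> card {B \<in> tuple_set k ` tuples n k. S \<subseteq> B}"
    using finite_tuples assms(2) by (intro card_mono) auto
  then have "real (card {B\<in>H. S \<subseteq> B}) \<le> real n powi (int k - int (card S))"
    using card_tuple_sets_containing[OF assms(1), of k S] by linarith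
  then have "real (card {B\<in>H. S \<subseteq> B}) * \<kappa> ^ card S \<le> real n powi (int k - int (card S)) * \<kappa> ^ card S"
    using assms(3) by (intro mult_right_mono) auto
  also have "\<dots> = \<kappa> ^ 3 * (real n powi (int k - int (card S)) * \<kappa> ^ t)" by (simp add: t power_add)
  also have "\<dots> \<le> \<kappa> ^ 3 * (real n powi (int k - int (card S)) * real n ^ t)"
    using assms by (intro mult_left_mono power_mono) auto
  also have "real n powi (int k - int (card S)) * real n ^ t = real n powi (int k - 3)"
    using assms(1) t by (simp add: power_int_add[symmetric] flip: power_int_of_nat)
  finally show ?thesis using S(2) by simp
qed

lemma finite_heavy: "finite X \<Longrightarrow> finite (heavy d X \<S>)"
  unfolding heavy_def by simp

text \<open>A set of the collection inside B either contains a heavy vertex or is a light pair: it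
  is nonempty, and the point of a singleton in the collection is heavy. So B contains a heavy vertex
  or a light pair, and these are counted separately.\<close>

lemma card_covered_le:
  assumes "0 < n" "H \<subseteq> tuple_set k ` tuples n k" "finite X"
    and \<S>: "\<And>S. S \<in> \<S> \<Longrightarrow> S \<subseteq> X \<and> card S \<le> 2" "{} \<notin> \<S>"
    and cov: "\<And>B. B \<in> H \<Longrightarrow> \<exists>S\<in>\<S>. S \<subseteq> B"
  shows "real (card H) \<le> real (card (heavy d X \<S>)) * real n powi (int k - 1)
    + real (card (light_pairs d X \<S>)) * real n powi (int k - 2)"
proof -
  let ?c = "\<lambda>T. {B \<in> tuple_set k ` tuples n k. T \<subseteq> B}"
  let ?V = "heavy d X \<S>" and ?P = "light_pairs d X \<S>"
  have finc: "finite (?c T)" for T using finite_tuples by auto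
  have finV: "finite ?V" using assms(3) by (rule finite_heavy)
  have "?P \<subseteq> Pow X" unfolding light_pairs_def using \<S> by auto
  then have finP: "finite ?P" using assms(3) finite_subset by auto
  have "H \<subseteq> (\<Union>v\<in>?V. ?c {v}) \<union> (\<Union>S\<in>?P. ?c S)"
  proof
    fix B assume B: "B \<in> H"
    then have BT: "B \<in> tuple_set k ` tuples n k" using assms(2) by auto
    obtain S where S: "S \<in> \<S>" "S \<subseteq> B" using cov[OF B] by auto
    show "B \<in> (\<Union>v\<in>?V. ?c {v}) \<union> (\<Union>S\<in>?P. ?c S)"
    proof (cases "S \<inter> ?V = {}")
      case False
      then show ?thesis using BT S by auto
    next
      case True
      have SX: "S \<subseteq> X" "card S \<le> 2" "S \<noteq> {}" using \<S> S by auto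
      then have "card S \<noteq> 0" using assms(3) finite_subset by (metis card_0_eq)
      moreover have "card S \<noteq> 1"
      proof
        assume "card S = 1"
        then obtain v where "S = {v}" by (auto simp: card_1_singleton_iff)
        then have "v \<in> ?V" using S SX unfolding heavy_def by auto
        then show False using True \<open>S = {v}\<close> by auto
      qed
      ultimately have "S \<in> ?P" using SX S True unfolding light_pairs_def by auto
      then show ?thesis using BT S by auto
    qed
  qed
  then have "card H \<le> card ((\<Union>v\<in>?V. ?c {v}) \<union> (\<Union>S\<in>?P. ?c S))"
    by (intro card_mono finite_UnI finite_UN_I finV finP finc)
  also have "\<dots> \<le> card (\<Union>v\<in>?V. ?c {v}) + card (\<Union>S\<in>?P. ?c S)" by (rule card_Un_le)
  also have "\<dots> \<le> (\<Sum>v\<in>?V. card (?c {v})) + (\<Sum>S\<in>?P. card (?c S))"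
    using finV finP by (intro add_mono card_UN_le)
  finally have "real (card H) \<le> real ((\<Sum>v\<in>?V. card (?c {v})) + (\<Sum>S\<in>?P. card (?c S)))"
    by (rule of_nat_mono)
  also have "\<dots> = (\<Sum>v\<in>?V. real (card (?c {v}))) + (\<Sum>S\<in>?P. real (card (?c S)))"
    by (simp only: of_nat_add of_nat_sum)
  also have "\<dots> \<le> (\<Sum>v\<in>?V. real n powi (int k - 1)) + (\<Sum>S\<in>?P. real n powi (int k - 2))"
  proof (intro add_mono sum_mono)
    fix v show "real (card (?c {v})) \<le> real n powi (int k - 1)"
      using card_tuple_sets_containing[OF assms(1), of k "{v}"] by simp
  next
    fix S assume "S \<in> ?P"
    then show "real (card (?c S)) \<le> real n powi (int k - 2)"
      using card_tuple_sets_containing[OF assms(1), of k S] unfolding light_pairs_def by simp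
  qed
  finally show ?thesis by simp
qed

section \<open>Numerical constants and assembly of the proof\<close>

lemma exists_colour_count:
  fixes s k :: nat
  assumes "2 \<le> s" "1 \<le> k"
  obtains b where "0 < b" "s * k < 2 ^ b" "1 \<le> log 2 (real (s * k))"
    "16 * real (s * b - 1) + real (2 * (s - 1)) \<le> 32 * real s * log 2 (real (s * k))"
proof -
  define L where "L = log 2 (real (s * k))"
  \<comment> \<open>The least integer above L, so that 2^b > sk while b \<le> L + 1.\<close>
  define b where "b = nat \<lfloor>L\<rfloor> + 1"
  have sk: "s \<le> s * k" using assms by simp
  have "log 2 (real s) \<le> L" unfolding L_def using assms sk by (intro log_mono) (auto simp del: of_nat_mult)
  moreover have "1 \<le> log 2 (real s)" using assms by (simp add: le_log_iff)
  \<comment> \<open>The value 9/8 = 18/16 is what the final estimate needs for s \<ge> 3.\<close>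
  moreover have "9 / 8 \<le> log 2 (real s)" if "s \<noteq> 2"
  proof -
    have "2 powr 9 \<le> (3::real) ^ 8" by (simp add: powr_numeral)
    then have "9 \<le> log 2 ((3::real) ^ 8)" by (simp add: le_log_iff)
    also have "log 2 ((3::real) ^ 8) = real 8 * log 2 3" by (rule log_nat_power) simp
    finally have "9 / 8 \<le> log 2 (3::real)" by simp
    also have "\<dots> \<le> log 2 (real s)" using that assms(1) by (intro log_mono) auto
    finally show ?thesis .
  qed
  ultimately have L: "1 \<le> L" "s \<noteq> 2 \<Longrightarrow> 9 / 8 \<le> L" by auto
  have bL: "L < real b" "real b \<le> L + 1" unfolding b_def using L(1) by linarith+
  have "real (s * k) = 2 powr L" unfolding L_def using assms by (simp add: powr_log_cancel)
  also have "\<dots> < 2 powr real b" using bL by simp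
  also have "\<dots> = real (2 ^ b)" by (simp add: powr_realpow)
  finally have 1: "s * k < 2 ^ b" by (simp only: of_nat_less_iff)
  have "1 \<le> s * b" using assms unfolding b_def by simp
  then have e: "16 * real (s * b - 1) + real (2 * (s - 1)) = 16 * (real s * real b) + 2 * real s - 18"
    using assms(1) by (simp add: of_nat_diff)
  have "real s * real b \<le> real s * (L + 1)" using bL(2) by (intro mult_left_mono) auto
  \<comment> \<open>What remains after inserting b \<le> L + 1. For s = 2 and k = 1 only L = 1 is
    available, but there the term -18 makes up for it.\<close>
  moreover have "18 * real s - 18 \<le> 16 * (real s * L)"
  proof (cases "s = 2")
    case False
    then have "real s * (9 / 8) \<le> real s * L" using L by (intro mult_left_mono) auto
    then show ?thesis by simp
  qed (use L in simp)
  ultimately have "16 * real (s * b - 1) + real (2 * (s - 1)) \<le> 32 * real s * L"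
    unfolding e by (simp add: algebra_simps)
  then show thesis using that[of b] 1 L(1) unfolding L_def b_def by simp
qed

text \<open>The three terms of the bound have three sources: fewer than i heavy vertices, at most
  d^2 light pairs, and the members containing no set of \<open>\<S> i\<close>. The condition s \<ge>
  2 makes the logarithm at least 1, hence \<kappa> positive.\<close>

lemma rainbow_matching_of_large_tuple_families:
  fixes n k s :: nat
  assumes "0 < n" "0 < k" "2 \<le> s" and n: "32 * real s * log 2 (real (s * k)) < real n"
    and \<F>: "\<And>i. i \<in> {1..s} \<Longrightarrow> \<F> i \<subseteq> tuples n k"
    and large: "\<And>i. i \<in> {1..s} \<Longrightarrow>
      (real i - 1) * real n powi (int k - 1) + (2 * (real s - 1))\<^sup>2 * real n powi (int k - 2)
      + (32 * real s * log 2 (real (s * k))) ^ 3 * real n powi (int k - 3) < real (card (\<F> i))"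
  shows "\<exists>F. (\<forall>i\<in>{1..s}. F i \<in> \<F> i) \<and> disjoint_family_on (\<lambda>i. tuple_set k (F i)) {1..s}"
proof -
  define \<kappa> where "\<kappa> = 32 * real s * log 2 (real (s * k))"
  define X where "X = {1..k} \<times> {1..n}"
  define H where "H i = tuple_set k ` \<F> i" for i
  define d where "d = 2 * (s - 1)"
  define \<S> where "\<S> i = {S\<in>Pow X. card S \<le> 2 \<and> (\<exists>G\<subseteq>H i. spread_above \<kappa> G S)}" for i
  obtain b where b: "0 < b" "s * k < 2 ^ b" "1 \<le> log 2 (real (s * k))"
    and \<kappa>b: "16 * real (s * b - 1) + real d \<le> \<kappa>"
    using exists_colour_count[of s k] assms(2,3) unfolding \<kappa>_def d_def by (metis One_nat_def Suc_leI)
  have "0 < 32 * real s" using assms(3) by simp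
  then have \<kappa>0: "0 < \<kappa>" unfolding \<kappa>_def using b(3) by (intro mult_pos_pos) auto
  have \<kappa>n: "\<kappa> \<le> real n" using n unfolding \<kappa>_def by simp
  have finX: "finite X" unfolding X_def by simp
  have HT: "H i \<subseteq> tuple_set k ` tuples n k" if "i \<in> {1..s}" for i
    unfolding H_def using \<F>[OF that] by auto
  have HX: "B \<subseteq> X" if "i \<in> {1..s}" "B \<in> H i" for i B
    using HT[OF that(1)] that(2) tuple_set_subset unfolding X_def by blast
  have cardH: "card (H i) = card (\<F> i)" if "i \<in> {1..s}" for i
    unfolding H_def by (rule card_image[OF inj_on_subset[OF inj_on_tuple_set \<F>[OF that]]])
  have "real d = 2 * (real s - 1)" using assms(3) unfolding d_def by (simp add: of_nat_diff)
  then have dreal: "real (d\<^sup>2) = (2 * (real s - 1))\<^sup>2" by simp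
  have rich: "{} \<in> \<S> i \<or> i \<le> card (heavy d X (\<S> i)) \<or> d\<^sup>2 < card (light_pairs d X (\<S> i))"
    if i: "i \<in> {1..s}" for i
  proof (rule ccontr)
    assume neg: "\<not> ?thesis"
    define K where "K = {B\<in>H i. \<exists>S\<in>\<S> i. S \<subseteq> B}"
    have finH: "finite (H i)" by (rule finite_subset[OF HT[OF i]]) (simp add: finite_tuples)
    have "real (card (H i - K)) \<le> \<kappa> ^ 3 * real n powi (int k - 3)"
    proof (rule card_le_of_spread_above_large[OF assms(1) _ \<kappa>0 \<kappa>n])
      show "H i - K \<subseteq> tuple_set k ` tuples n k" using HT[OF i] by auto
      fix G S assume G: "G \<subseteq> H i - K" "spread_above \<kappa> G S"
      then obtain B where B: "B \<in> G" "S \<subseteq> B" unfolding spread_above_def by auto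
      then have SX: "S \<subseteq> X" using G(1) HX[OF i] by blast
      \<comment> \<open>A set S of size at most 2 would belong to \<open>\<S> i\<close>; the members
        of G contain S and would then lie in K.\<close>
      show "3 \<le> card S"
      proof (rule ccontr)
        assume "\<not> 3 \<le> card S"
        then have "S \<in> \<S> i" unfolding \<S>_def using SX G by auto
        then show False using B G(1) unfolding K_def by auto
      qed
    qed
    moreover have "real (card K) \<le> real (card (heavy d X (\<S> i))) * real n powi (int k - 1)
      + real (card (light_pairs d X (\<S> i))) * real n powi (int k - 2)"
      by (rule card_covered_le[OF assms(1) _ finX]) (use HT[OF i] neg in \<open>auto simp: K_def \<S>_def\<close>)
    moreover have "real (card (heavy d X (\<S> i))) * real n powi (int k - 1) \<le> (real i - 1) * real n powi (int k - 1)"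
      using neg by (intro mult_right_mono) auto
    moreover have "real (card (light_pairs d X (\<S> i))) * real n powi (int k - 2) \<le> real (d\<^sup>2) * real n powi (int k - 2)"
      using neg by (intro mult_right_mono) (auto simp del: of_nat_power)
    moreover have "card (H i) = card K + card (H i - K)"
      using finH card_Diff_subset[of K "H i"] card_mono[of "H i" K] finite_subset[of K "H i"]
      unfolding K_def by auto
    ultimately show False using large[OF i] cardH[OF i] unfolding dreal \<kappa>_def by simp
  qed
  have "\<exists>F. (\<forall>i\<in>{1..s}. F i \<in> \<S> i) \<and> disjoint_family_on F {1..s}"
    by (rule disjoint_small_sets[OF finX d_def _ rich]) (auto simp: \<S>_def)
  then obtain S where S: "\<And>i. i \<in> {1..s} \<Longrightarrow> S i \<in> \<S> i" "disjoint_family_on S {1..s}" by blast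
  then have "\<forall>i\<in>{1..s}. \<exists>G. G \<subseteq> H i \<and> spread_above \<kappa> G (S i)" unfolding \<S>_def by blast
  then obtain G where G: "\<And>i. i \<in> {1..s} \<Longrightarrow> G i \<subseteq> H i" "\<And>i. i \<in> {1..s} \<Longrightarrow> spread_above \<kappa> (G i) (S i)"
    by metis
  define U where "U i = (\<Union>j\<in>{1..s} - {i}. S j)" for i
  define G' where "G' i = {B\<in>G i. B \<inter> U i = {}}" for i
  have Sfin: "finite (S i)" "card (S i) \<le> 2" if "i \<in> {1..s}" for i
    using S(1)[OF that] finX finite_subset unfolding \<S>_def by auto
  have Ufin: "finite (U i)" for i unfolding U_def using Sfin by auto
  have Ucard: "card (U i) \<le> d" if i: "i \<in> {1..s}" for i
  proof -
    have "card (U i) \<le> (\<Sum>j\<in>{1..s} - {i}. card (S j))" unfolding U_def by (intro card_UN_le) auto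
    also have "\<dots> \<le> (\<Sum>j\<in>{1..s} - {i}. 2)" using Sfin by (intro sum_mono) auto
    finally show ?thesis using i unfolding d_def by simp
  qed
  have US: "U i \<inter> S i = {}" if "i \<in> {1..s}" for i
    using S(2) that unfolding U_def disjoint_family_on_def by blast
  \<comment> \<open>Discarding the members that meet \<open>U i\<close> lowers the spread parameter
    from \<kappa> to this value, exactly what \<open>rainbow_matching_of_spread\<close> demands for
    s families with b colours each.\<close>
  let ?R = "16 * real (s * b - 1)"
  have R: "0 \<le> ?R" "?R + real (card (U i)) \<le> \<kappa>" if "i \<in> {1..s}" for i
    using \<kappa>b Ucard[OF that] by auto
  have GX: "finite (G i)" "G i \<noteq> {}" if "i \<in> {1..s}" for i
    using G(2)[OF that] unfolding spread_above_def by auto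
  \<comment> \<open>Only the parts outside \<open>S i\<close> are matched, since spreadness concerns
    sets T disjoint from \<open>S i\<close>; a T meeting \<open>S i\<close> lies in no such
    part.\<close>
  have "\<exists>F. (\<forall>i\<in>{1..s}. F i \<in> G' i) \<and> disjoint_family_on (\<lambda>i. F i - S i) {1..s}"
  proof (rule rainbow_matching_of_spread[OF finX _ b(1)])
    show "finite {1..s}" "card {1..s} * k < 2 ^ b" using b by auto
    fix i assume i: "i \<in> {1..s}"
    show "finite (G' i)" unfolding G'_def using GX(1)[OF i] by auto
    \<comment> \<open>At least two colours in all make \<open>?R\<close> positive, so some members
      survive.\<close>
    have "2 \<le> s * b" using assms(3) b(1) by (metis One_nat_def Suc_leI le_trans mult_le_mono nat_mult_1_right)
    then have "0 < ?R" by simp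
    then have "0 < real (card (G i)) * ?R" using GX[OF i] by (simp add: card_gt_0_iff)
    also have "\<dots> \<le> real (card (G' i)) * \<kappa>"
      unfolding G'_def using spread_above_avoiding(2)[OF G(2)[OF i] Ufin US[OF i] R[OF i] \<kappa>0, of "{}"] by simp
    finally show "G' i \<noteq> {}" by auto
    fix T assume T: "T \<subseteq> X"
    show "real (card {B\<in>G' i. T \<subseteq> B - S i}) * (16 * real (card {1..s} * b - 1)) ^ card T \<le> real (card (G' i))"
    proof (cases "T \<inter> S i = {}")
      case True
      then have "{B\<in>G' i. T \<subseteq> B - S i} = {B\<in>G i. B \<inter> U i = {} \<and> T \<subseteq> B}" unfolding G'_def by auto
      then show ?thesis
        using spread_above_avoiding(1)[OF G(2)[OF i] Ufin US[OF i] R[OF i] \<kappa>0 finite_subset[OF T finX] True]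
        unfolding G'_def by simp
    next
      case False
      then have "{B\<in>G' i. T \<subseteq> B - S i} = {}" by auto
      then show ?thesis by (simp only: card.empty)
    qed
  next
    fix i B assume i: "i \<in> {1..s}" and "B \<in> G' i"
    then have B: "B \<in> H i" using G(1) unfolding G'_def by auto
    then show "B - S i \<subseteq> X" using HX[OF i] by auto
    have "finite B" using HX[OF i B] finX finite_subset by auto
    moreover have "card B = k" using B card_tuple_set unfolding H_def by auto
    ultimately show "card (B - S i) \<le> k" using card_mono[of B "B - S i"] by auto
  qed
  then obtain B where B: "\<And>i. i \<in> {1..s} \<Longrightarrow> B i \<in> G' i" "disjoint_family_on (\<lambda>i. B i - S i) {1..s}" by blast
  have "\<forall>i\<in>{1..s}. \<exists>x\<in>\<F> i. B i = tuple_set k x"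
    using B(1) G(1) unfolding G'_def H_def by blast
  then obtain F where F: "\<And>i. i \<in> {1..s} \<Longrightarrow> F i \<in> \<F> i" "\<And>i. i \<in> {1..s} \<Longrightarrow> B i = tuple_set k (F i)" by metis
  have "tuple_set k (F i) \<inter> tuple_set k (F j) = {}" if ij: "i \<in> {1..s}" "j \<in> {1..s}" "i \<noteq> j" for i j
  proof -
    have "B i \<inter> S j = {}" "B j \<inter> S i = {}"
      using B(1)[OF ij(1)] B(1)[OF ij(2)] ij unfolding G'_def U_def by blast+
    moreover have "(B i - S i) \<inter> (B j - S j) = {}" using B(2) ij unfolding disjoint_family_on_def by auto
    ultimately have "B i \<inter> B j = {}" by auto
    then show ?thesis using F(2) ij by simp
  qed
  then show ?thesis using F(1) unfolding disjoint_family_on_def by blast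
qed

theorem theorem5:
  fixes n k s :: nat
  assumes "n > 0" and "k > 0" and "s > 0"
    and "real n > 2^5 * real s * log 2 (real (s * k))"
  shows "satisfying n k s (\<lambda>i.
      (real i - 1) * real n powi (int k - 1)
      + 4 * (real s - 1)^2 * real n powi (int k - 2)
      + 2^15 * real s^3 * (log 2 (real (s * k)))^3 * real n powi (int k - 3))"
  unfolding satisfying_def
proof (intro allI impI)
  fix \<F> :: "nat \<Rightarrow> (nat \<Rightarrow> nat) set"
  let ?f = "\<lambda>i. (real i - 1) * real n powi (int k - 1)
      + 4 * (real s - 1)^2 * real n powi (int k - 2)
      + 2^15 * real s^3 * (log 2 (real (s * k)))^3 * real n powi (int k - 3)"
  assume *: "\<forall>i\<in>{1..s}. \<F> i \<subseteq> tuples n k \<and> ?f i < real (card (\<F> i))"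
  show "\<exists>F. (\<forall>i\<in>{1..s}. F i \<in> \<F> i) \<and> disjoint_family_on (\<lambda>i. tuple_set k (F i)) {1..s}"
  proof (cases "s = 1")
    case True
    \<comment> \<open>For s = k = 1 the logarithm vanishes, so this case is separate: a nonnegative
      bound already forces the only family to be nonempty.\<close>
    have "1 \<le> real (s * k)" using assms(2) True by (simp add: Suc_le_eq)
    then have "0 \<le> log 2 (real (s * k))" by (simp del: of_nat_mult)
    then have "0 \<le> ?f 1" using True by (intro add_nonneg_nonneg mult_nonneg_nonneg) auto
    then have "\<F> 1 \<noteq> {}" using * True by force
    then show ?thesis using True by (auto simp: disjoint_family_on_def)
  next
    case False
    show ?thesis
    proof (rule rainbow_matching_of_large_tuple_families[OF assms(1,2)])
      show "2 \<le> s" using assms(3) False by simp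
      show "32 * real s * log 2 (real (s * k)) < real n" using assms(4) by simp
      fix i assume i: "i \<in> {1..s}"
      then show "\<F> i \<subseteq> tuples n k" using * by blast
      have "(2 * (real s - 1))\<^sup>2 = 4 * (real s - 1)\<^sup>2" by (simp only: power_mult_distrib) simp
      moreover have "(32 * real s * log 2 (real (s * k))) ^ 3 = 2 ^ 15 * real s ^ 3 * log 2 (real (s * k)) ^ 3"
        by (simp only: power_mult_distrib) simp
      ultimately show "(real i - 1) * real n powi (int k - 1) + (2 * (real s - 1))\<^sup>2 * real n powi (int k - 2)
        + (32 * real s * log 2 (real (s * k))) ^ 3 * real n powi (int k - 3) < real (card (\<F> i))"
        using * i by simp
    qed
  qed
qed

end
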